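(* Let $p$ be an odd prime, $m$ even, $M=\mathbb F_{p^m}$, $Q=p^{m/2}$, $1\le k\le m-1$, $q=p^k$, $r=p^{k+m/2}$, $e=\gcd(k,m)$ with $m/e$ odd, $d=\gcd(k+m/2,m)$, $\mathbb E=\mathbb F_{p^e}$, $\mathbb D=\mathbb F_{p^d}$, $B\in M$ a non-square, $A\in M$ with $AB\in\mathbb F_Q^\times$, and $\mathcal C$ as in the context. Let $(X,Y)\in\mathrm{Aut}(\mathcal C)$ with $X(x,y)=(f_1(x)+f_2(y),f_3(x)+f_4(y))$ and $Y(x,y)=(g_1(x)+g_2(y),g_3(x)+g_4(y))$, where $X$ is semilinear over $\mathbb D$, $Y$ is semilinear over $\mathbb E$, and $X$ is in diagonal form, i.e. $f_2=f_3=0$. Then $f_1,f_4,g_1,g_2,g_3,g_4$ are all monomials.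
   Context: $\mathcal C=\{R_{u,v}:u,v\in M\}$, where $R_{u,v}(x,y)=(x^qu+xu^q+B(y^qv+yv^q),\ x^rv+Axv^r+Ay^ru+yu^r)$. $\mathrm{Aut}(\mathcal C)$ is the set of pairs $(X,Y)$ of invertible $\mathbb F_p$-linear maps of $M\times M$ such that for every $(u,v)$ there is $(w,t)$ with $X\circ R_{u,v}=R_{w,t}\circ Y$. The $f_i,g_i$ are $\mathbb F_p$-linear maps $M\to M$. A map $Z$ is semilinear over a subfield $K\subseteq M$ if it is additive and there is an automorphism $\sigma$ of $K$ with $Z(\lambda\cdot z)=\sigma(\lambda)Z(z)$ for all $\lambda\in K$. A monomial is a map $x\mapsto ax^{p^j}$ with $a\in M$, $j\ge0$. *)

theory Defs
  imports Complex_Main "HOL-Computational_Algebra.Primes" "HOL-Library.Cardinality" "HOL-Library.Product_Plus"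
begin

definition is_subfield :: "'a::field set \<Rightarrow> bool" where
  "is_subfield K \<longleftrightarrow> 0 \<in> K \<and> 1 \<in> K \<and>
     (\<forall>x\<in>K. \<forall>y\<in>K. x + y \<in> K \<and> x * y \<in> K) \<and>
     (\<forall>x\<in>K. - x \<in> K \<and> inverse x \<in> K)"

definition field_automorphism :: "'a::field set \<Rightarrow> ('a \<Rightarrow> 'a) \<Rightarrow> bool" where
  "field_automorphism K \<sigma> \<longleftrightarrow> bij_betw \<sigma> K K \<and>
     (\<forall>x\<in>K. \<forall>y\<in>K. \<sigma> (x + y) = \<sigma> x + \<sigma> y \<and> \<sigma> (x * y) = \<sigma> x * \<sigma> y)"

text \<open>The prime subfield: in a field of characteristic \<open>p\<close> this is the copy
  \<open>{0, 1, \<dots>, p - 1}\<close> of the field with \<open>p\<close> elements.\<close>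

definition prime_subfield :: "'a::field set" where
  "prime_subfield = range of_nat"

text \<open>In the next two definitions \<open>s\<close> is the scalar multiplication of the space on which
  the map acts: \<open>(*)\<close> on \<open>M\<close> and \<open>scale2\<close> on \<open>M \<times> M\<close>.\<close>

definition linear_over ::
    "'a::field set \<Rightarrow> ('a \<Rightarrow> 'v \<Rightarrow> 'v) \<Rightarrow> ('v::ab_group_add \<Rightarrow> 'v) \<Rightarrow> bool" where
  "linear_over K s Z \<longleftrightarrow> Modules.additive Z \<and> (\<forall>c\<in>K. \<forall>z. Z (s c z) = s c (Z z))"

definition semilinear_over ::
    "'a::field set \<Rightarrow> ('a \<Rightarrow> 'v \<Rightarrow> 'v) \<Rightarrow> ('v::ab_group_add \<Rightarrow> 'v) \<Rightarrow> bool" where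
  "semilinear_over K s Z \<longleftrightarrow> Modules.additive Z \<and>
     (\<exists>\<sigma>. field_automorphism K \<sigma> \<and> (\<forall>c\<in>K. \<forall>z. Z (s c z) = s (\<sigma> c) (Z z)))"

definition scale2 :: "'a::field \<Rightarrow> 'a \<times> 'a \<Rightarrow> 'a \<times> 'a" where
  "scale2 c z = (c * fst z, c * snd z)"

definition R_map :: "nat \<Rightarrow> nat \<Rightarrow> 'a::field \<Rightarrow> 'a \<Rightarrow> 'a \<Rightarrow> 'a \<Rightarrow> 'a \<times> 'a \<Rightarrow> 'a \<times> 'a" where
  "R_map q r A B u v = (\<lambda>(x, y).
     (x ^ q * u + x * u ^ q + B * (y ^ q * v + y * v ^ q),
      x ^ r * v + A * x * v ^ r + A * y ^ r * u + y * u ^ r))"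

definition C_set :: "nat \<Rightarrow> nat \<Rightarrow> 'a::field \<Rightarrow> 'a \<Rightarrow> ('a \<times> 'a \<Rightarrow> 'a \<times> 'a) set" where
  "C_set q r A B = {R_map q r A B u v | u v. True}"

definition Aut ::
    "('a::field \<times> 'a \<Rightarrow> 'a \<times> 'a) set \<Rightarrow> (('a \<times> 'a \<Rightarrow> 'a \<times> 'a) \<times> ('a \<times> 'a \<Rightarrow> 'a \<times> 'a)) set" where
  "Aut C = {(X, Y).
     bij X \<and> linear_over prime_subfield scale2 X \<and>
     bij Y \<and> linear_over prime_subfield scale2 Y \<and>
     (\<forall>R\<in>C. \<exists>R'\<in>C. X \<circ> R = R' \<circ> Y)}"

text \<open>The coefficient \<open>a\<close> may be zero, so the zero map counts as a monomial.\<close>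

definition is_monomial :: "nat \<Rightarrow> ('a::field \<Rightarrow> 'a) \<Rightarrow> bool" where
  "is_monomial p f \<longleftrightarrow> (\<exists>a j. f = (\<lambda>x. a * x ^ (p ^ j)))"

end

theory Submission
  imports Defs "HOL-Computational_Algebra.Polynomial" "HOL-Number_Theory.Cong"
begin

text \<open>The second component of \<open>X \<circ> R = R' \<circ> Y\<close> on \<open>x\<close>- and \<open>u\<close>-vectors in the same coordinate axis
  vanishes; scaling by an element of \<open>EE\<close> moved by \<open>\<lambda> \<mapsto> \<lambda> ^ r\<close> splits it into two equations, which say
  that \<open>Y\<close> maps each axis onto a line \<open>M \<cdot> \<xi>\<close>, and likewise for \<open>(u, v) \<mapsto> (w, t)\<close>.
  The first component then becomes \<open>f (x ^ q u + x u ^ q) = c G(x) ^ q H(u) + c' G(x) H(u) ^ q\<close>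
  with \<open>G\<close> bijective, and the symmetry in \<open>x\<close> and \<open>u\<close> makes \<open>H\<close> a multiple of \<open>G\<close>. Comparing
  coefficients of \<open>x ^ (p ^ i) u ^ (p ^ j)\<close>, where the diagonal ones vanish and \<open>p\<close> is odd,
  leaves only one term in \<open>G\<close>. Since \<open>m / e\<close> is odd, \<open>x ^ q + x\<close> is onto, so \<open>f\<close> is a monomial too.
  Finally \<open>f\<^sub>4\<close> is found from the second component by comparing coefficients once more.\<close>

section \<open>Power maps on finite fields and linear maps over a subfield\<close>

lemma card_roots_power_diff_le:
  fixes a b :: nat
  assumes "a < b"
  shows "card {x::'a::field. x ^ a = x ^ b} \<le> b"
proof -
  let ?P = "monom 1 b - monom 1 a :: 'a poly"
  have "coeff ?P b = 1"
    using assms by simp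
  then have "?P \<noteq> 0"
    by (metis coeff_0 zero_neq_one)
  then have "card {x. poly ?P x = 0} \<le> degree ?P"
    by (rule card_poly_roots_bound)
  also have "degree ?P \<le> b"
    using assms by (intro degree_diff_le) (auto simp: degree_monom_eq)
  finally show ?thesis
    by (simp add: poly_monom eq_commute[of "_ ^ a"])
qed

text \<open>Multiplication by a nonzero \<open>x\<close> in \<open>K\<close> permutes
  \<open>K - {0}\<close>, so the product of all nonzero elements cancels.\<close>

lemma is_subfield_power_card:
  fixes K :: "'a::{field,finite} set"
  assumes K: "is_subfield K" and "x \<in> K"
  shows "x ^ card K = x"
proof (cases "x = 0")
  case True
  have "card K > 0"
    using assms by (auto simp: card_gt_0_iff)
  with True show ?thesis
    by simp
next
  case False
  have 1: "card K = Suc (card (K - {0}))"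
    using K card.remove[of K 0] by (auto simp: is_subfield_def)
  have "(\<Prod>y\<in>K-{0}. x * y) = (\<Prod>y\<in>K-{0}. y)"
    using False K \<open>x \<in> K\<close>
    by (intro prod.reindex_bij_witness[of _ "\<lambda>y. inverse x * y" "\<lambda>y. x * y"])
      (auto simp: is_subfield_def)
  then have "x ^ card (K - {0}) * \<Prod>(K - {0}) = \<Prod>(K - {0})"
    by (simp add: prod.distrib)
  moreover have "\<Prod>(K - {0}) \<noteq> 0"
    by simp
  ultimately have "x ^ card (K - {0}) = 1"
    by simp
  then show ?thesis
    by (simp add: 1)
qed

lemma linear_overD:
  assumes "linear_over K s Z"
  shows "Z (x + y) = Z x + Z y" and "Z 0 = 0" and "Z (x - y) = Z x - Z y"
    and "c \<in> K \<Longrightarrow> Z (s c x) = s c (Z x)"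
  using assms additive.add[of Z] additive.zero[of Z] additive.diff[of Z] by (auto simp: linear_over_def)

lemma linear_over_compose_cmult:
  assumes "linear_over K (*) Z"
  shows "linear_over K (*) (\<lambda>x. Z (c * x))"
  using linear_overD[OF assms]
  by (auto simp: linear_over_def Modules.additive_def distrib_left mult.left_commute)

lemma linear_over_cmult_compose:
  assumes "linear_over K (*) Z"
  shows "linear_over K (*) (\<lambda>x. c * Z x)"
  using linear_overD[OF assms]
  by (auto simp: linear_over_def Modules.additive_def algebra_simps)

lemma linear_over_sum:
  assumes "linear_over K (*) Z"
  shows "Z (sum g S) = (\<Sum>i\<in>S. Z (g i))"
  using linear_overD[OF assms] by (induction S rule: infinite_finite_induct) auto

section \<open>Frobenius powers in a field of order \<open>p ^ m\<close>\<close>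

locale finite_field_card =
  fixes p m :: nat and field_type :: "'a::{field,finite} itself"
  assumes prime_p: "prime p" and card_field: "CARD('a) = p ^ m"
begin

lemma m_pos: "m > 0"
proof (rule ccontr)
  assume "\<not> m > 0"
  then have "card {0, 1::'a} \<le> 1"
    using card_field card_mono[of UNIV "{0, 1::'a}"] by simp
  then show False
    by simp
qed

lemma char_eq: "CHAR('a) = p"
proof -
  have "CHAR('a) > 0"
    by (simp add: finite_imp_CHAR_pos)
  then have "prime CHAR('a)"
    using prime_CHAR_semidom by blast
  moreover have "CHAR('a) dvd p ^ m"
  proof -
    \<comment> \<open>The shift by \<open>1\<close> permutes the field, so the sum of
      \<open>p ^ m\<close> ones vanishes.\<close>
    have "(\<Sum>y\<in>UNIV. y + 1 :: 'a) = (\<Sum>y\<in>UNIV. y)"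
      by (rule sum.reindex_bij_witness[of _ "\<lambda>y. y - 1" "\<lambda>y. y + 1"]) auto
    then have "of_nat (p ^ m) = (0::'a)"
      unfolding sum.distrib sum_constant card_field by simp
    then show ?thesis
      by (simp only: of_nat_eq_0_iff_char_dvd)
  qed
  ultimately show ?thesis
    using prime_p by (meson prime_dvd_power primes_dvd_imp_eq)
qed

lemma frobenius_add: "(x + y :: 'a) ^ (p ^ n) = x ^ (p ^ n) + y ^ (p ^ n)"
  using char_eq prime_p by (intro freshmans_dream') auto

lemma frobenius_sum: "(sum g S :: 'a) ^ (p ^ n) = (\<Sum>i\<in>S. g i ^ (p ^ n))"
  using char_eq prime_p by (intro freshmans_dream_sum') auto

lemma frobenius_zero: "(0::'a) ^ (p ^ n) = 0"
  using prime_p by (simp add: prime_gt_0_nat)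

lemma frobenius_diff: "(x - y :: 'a) ^ (p ^ n) = x ^ (p ^ n) - y ^ (p ^ n)"
  using frobenius_add[of "x - y" y n] by (simp add: algebra_simps)

lemma frobenius_uminus: "(- x :: 'a) ^ (p ^ n) = - (x ^ (p ^ n))"
  using frobenius_diff[of 0 x n] by (simp add: frobenius_zero)

lemma frobenius_of_nat: "(of_nat a :: 'a) ^ (p ^ n) = of_nat a"
  by (induction a) (simp_all add: frobenius_add frobenius_zero)

lemma power_field_card: "(x :: 'a) ^ (p ^ m) = x"
  using is_subfield_power_card[of "UNIV :: 'a set" x] card_field by (simp add: is_subfield_def)

lemma power_field_card_power: "(x :: 'a) ^ (p ^ (m * t)) = x"
  by (induction t) (simp_all add: power_add power_mult power_field_card)

lemma frobenius_mod: "(x :: 'a) ^ (p ^ n) = x ^ (p ^ (n mod m))"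
proof -
  have "x ^ (p ^ n) = x ^ (p ^ (m * (n div m) + n mod m))"
    by simp
  also have "\<dots> = x ^ (p ^ (n mod m))"
    by (simp only: power_add[of p] power_mult[of x] power_field_card_power)
  finally show ?thesis .
qed

lemma frobenius_cong:
  assumes "[i = n] (mod m)"
  shows "(x :: 'a) ^ (p ^ i) = x ^ (p ^ n)"
  by (metis assms cong_def frobenius_mod)

lemma frobenius_distinct:
  assumes "\<not> [i = n] (mod m)"
  obtains y :: 'a where "y \<noteq> 0" "y ^ (p ^ i) \<noteq> y ^ (p ^ n)"
proof -
  have *: "\<exists>y::'a. y ^ (p ^ i) \<noteq> y ^ (p ^ n)" if "i < n" "n < m" for i n
  proof (rule ccontr)
    assume "\<not> ?thesis"
    then have "{x::'a. x ^ (p ^ i) = x ^ (p ^ n)} = UNIV"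
      by auto
    moreover have "p ^ i < p ^ n" "p ^ n < p ^ m"
      using that prime_gt_1_nat[OF prime_p] by auto
    ultimately show False
      using card_roots_power_diff_le[of "p ^ i" "p ^ n", where ?'a = 'a] card_field by simp
  qed
  have "i mod m \<noteq> n mod m" "i mod m < m" "n mod m < m"
    using assms m_pos by (auto simp: cong_def)
  then have "\<exists>y::'a. y ^ (p ^ (i mod m)) \<noteq> y ^ (p ^ (n mod m))"
    using *[of "i mod m" "n mod m"] *[of "n mod m" "i mod m"] by (metis linorder_neqE_nat)
  then obtain y :: 'a where y: "y ^ (p ^ i) \<noteq> y ^ (p ^ n)"
    by (metis frobenius_mod)
  moreover from y have "y \<noteq> 0"
    by (auto simp: frobenius_zero)
  ultimately show ?thesis
    by (rule that[rotated])
qed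

section \<open>Coefficients of linearized polynomials\<close>

text \<open>The coefficient of \<open>x ^ (p ^ n)\<close> in \<open>F\<close>, by orthogonality of the characters
  \<open>y \<mapsto> y ^ (p ^ n)\<close> of the multiplicative group.\<close>

definition lin_coeff :: "('a \<Rightarrow> 'a) \<Rightarrow> nat \<Rightarrow> 'a" where
  "lin_coeff F n = - (\<Sum>y\<in>UNIV - {0}. F y / y ^ (p ^ n))"

lemma lin_coeff_add: "lin_coeff (\<lambda>x. F x + G x) n = lin_coeff F n + lin_coeff G n"
  by (simp add: lin_coeff_def sum.distrib add_divide_distrib)

lemma lin_coeff_cmult: "lin_coeff (\<lambda>x. c * F x) n = c * lin_coeff F n"
  by (simp add: lin_coeff_def sum_distrib_left)

lemma lin_coeff_cmult': "lin_coeff (\<lambda>x. F x * c) n = lin_coeff F n * c"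
  by (simp add: lin_coeff_def sum_distrib_right)

lemma lin_coeff_zero: "lin_coeff (\<lambda>x. 0) n = 0"
  by (simp add: lin_coeff_def)

lemma lin_coeff_sum: "lin_coeff (\<lambda>x. \<Sum>i\<in>S. F i x) n = (\<Sum>i\<in>S. lin_coeff (F i) n)"
  by (induction S rule: infinite_finite_induct) (simp_all add: lin_coeff_zero lin_coeff_add)

lemma lin_coeff_power: "lin_coeff (\<lambda>x. F x ^ (p ^ k)) (n + k) = lin_coeff F n ^ (p ^ k)"
  by (simp add: lin_coeff_def frobenius_uminus frobenius_sum power_divide power_add power_mult)

text \<open>Congruent exponents give a sum of \<open>p ^ m - 1\<close> ones, which is
  \<open>-1\<close>; hence the sign in \<open>lin_coeff\<close>. Otherwise scaling \<open>y\<close>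
  by a suitable \<open>z\<close> multiplies the sum by a factor other than \<open>1\<close>.\<close>

lemma lin_coeff_monom: "lin_coeff (\<lambda>x. x ^ (p ^ i)) n = (if [i = n] (mod m) then 1 else 0)"
proof (cases "[i = n] (mod m)")
  case True
  then have "(\<Sum>y\<in>UNIV - {0}. y ^ (p ^ i) / y ^ (p ^ n)) = (\<Sum>y\<in>UNIV - {0::'a}. 1::'a)"
    by (intro sum.cong) (auto simp: frobenius_cong[OF True])
  also have "\<dots> = of_nat (p ^ m - 1)"
    using card_field by (simp add: card_Diff_subset)
  also have "\<dots> = of_nat (p ^ m) - 1"
    using prime_p by (subst of_nat_diff) (auto simp: Suc_le_eq prime_gt_0_nat)
  also have "of_nat (p ^ m) = (0::'a)"
    using m_pos by (simp flip: char_eq)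
  finally show ?thesis
    using True by (simp add: lin_coeff_def)
next
  case False
  then obtain z :: 'a where z: "z \<noteq> 0" "z ^ (p ^ i) \<noteq> z ^ (p ^ n)"
    by (rule frobenius_distinct)
  let ?S = "\<Sum>y\<in>UNIV - {0::'a}. y ^ (p ^ i) / y ^ (p ^ n)"
  have "?S = (\<Sum>y\<in>UNIV - {0}. (z * y) ^ (p ^ i) / (z * y) ^ (p ^ n))"
    by (rule sum.reindex_bij_witness[of _ "\<lambda>y. z * y" "\<lambda>y. y / z"]) (use z in auto)
  also have "\<dots> = z ^ (p ^ i) / z ^ (p ^ n) * ?S"
    unfolding sum_distrib_left by (intro sum.cong) (auto simp: power_mult_distrib)
  finally have "(1 - z ^ (p ^ i) / z ^ (p ^ n)) * ?S = 0"
    by (simp add: algebra_simps)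
  then have "?S = 0"
    using z by simp
  then show ?thesis
    using False by (simp add: lin_coeff_def)
qed

text \<open>The equation \<open>x ^ p = x\<close> has at most \<open>p\<close> solutions, and the
  residues below \<open>p\<close> already supply that many.\<close>

lemma mem_prime_subfieldI:
  fixes z :: 'a
  assumes "z ^ p = z"
  shows "z \<in> prime_subfield"
proof -
  let ?R = "{x::'a. x ^ 1 = x ^ p}"
  have "inj_on (of_nat :: nat \<Rightarrow> 'a) {..<p}"
    by (auto simp: inj_on_def of_nat_eq_iff_cong_CHAR char_eq cong_def)
  then have "card (of_nat ` {..<p} :: 'a set) = p"
    by (simp add: card_image)
  moreover have "of_nat ` {..<p} \<subseteq> ?R"
    using frobenius_of_nat[of _ 1] by auto
  moreover have "card ?R \<le> p"
    by (intro card_roots_power_diff_le prime_gt_1_nat prime_p)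
  ultimately have "of_nat ` {..<p} = ?R"
    by (intro card_seteq) auto
  then show ?thesis
    using assms unfolding prime_subfield_def by (metis (mono_tags) image_mono mem_Collect_eq power_one_right subset_UNIV subsetD)
qed

lemma trace_mem_prime_subfield: "(\<Sum>n<m. (z::'a) ^ (p ^ n)) \<in> prime_subfield"
proof (rule mem_prime_subfieldI)
  have "(\<Sum>n<m. z ^ (p ^ n)) ^ p = (\<Sum>n<m. z ^ (p ^ Suc n))"
    using frobenius_sum[of "\<lambda>n. z ^ (p ^ n)" "{..<m}" 1] by (simp add: mult.commute flip: power_mult)
  also have "\<dots> = (\<Sum>n<Suc m. z ^ (p ^ n)) - z"
    by (subst sum.lessThan_Suc_shift) simp
  also have "\<dots> = (\<Sum>n<m. z ^ (p ^ n))"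
    by (simp add: power_field_card)
  finally show "(\<Sum>n<m. z ^ (p ^ n)) ^ p = (\<Sum>n<m. z ^ (p ^ n))" .
qed

text \<open>Moving the trace, which lies in the prime field, through \<open>F\<close> turns the expansion
  into \<open>F (x * (\<Sum>z. trace z / z))\<close> up to sign, and that sum is \<open>-1\<close>.\<close>

lemma lin_coeff_expansion:
  assumes F: "linear_over prime_subfield (*) F"
  shows "F x = (\<Sum>n<m. lin_coeff F n * x ^ (p ^ n))"
proof (cases "x = 0")
  case True
  then show ?thesis
    using linear_overD(2)[OF F] by (simp add: frobenius_zero)
next
  case False
  have "(\<Sum>n<m. lin_coeff F n * x ^ (p ^ n))
      = - (\<Sum>n<m. \<Sum>y\<in>UNIV - {0}. F y * (x / y) ^ (p ^ n))"
    by (simp add: lin_coeff_def sum_distrib_right sum_negf power_divide)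
  also have "(\<Sum>n<m. \<Sum>y\<in>UNIV - {0}. F y * (x / y) ^ (p ^ n))
      = (\<Sum>y\<in>UNIV - {0}. F y * (\<Sum>n<m. (x / y) ^ (p ^ n)))"
    by (subst sum.swap) (simp add: sum_distrib_left)
  \<comment> \<open>Substitute \<open>z = x / y\<close>; the inner sum becomes the trace of
    \<open>z\<close>.\<close>
  also have "\<dots> = (\<Sum>z\<in>UNIV - {0}. (\<Sum>n<m. z ^ (p ^ n)) * F (x / z))"
    by (rule sum.reindex_bij_witness[of _ "\<lambda>z. x / z" "\<lambda>z. x / z"])
      (use False in \<open>auto simp: mult.commute\<close>)
  also have "\<dots> = (\<Sum>z\<in>UNIV - {0}. F ((\<Sum>n<m. z ^ (p ^ n)) * (x / z)))"
    by (intro sum.cong refl linear_overD(4)[OF F, symmetric] trace_mem_prime_subfield)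
  also have "\<dots> = F (\<Sum>z\<in>UNIV - {0}. (\<Sum>n<m. z ^ (p ^ n)) * (x / z))"
    by (rule linear_over_sum[OF F, symmetric])
  also have "(\<Sum>z\<in>UNIV - {0}. (\<Sum>n<m. z ^ (p ^ n)) * (x / z))
      = x * (\<Sum>z\<in>UNIV - {0}. \<Sum>n<m. z ^ (p ^ n) / z)"
    by (simp add: sum_distrib_left sum_distrib_right mult_ac)
  also have "(\<Sum>z\<in>UNIV - {0::'a}. \<Sum>n<m. z ^ (p ^ n) / z) = (\<Sum>n<m. - lin_coeff (\<lambda>z. z ^ (p ^ n)) 0)"
    by (subst sum.swap) (simp add: lin_coeff_def)
  also have "\<dots> = (\<Sum>n<m. if n = 0 then -1 else 0)"
    by (intro sum.cong) (auto simp: lin_coeff_monom cong_def)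
  also have "\<dots> = -1"
    using m_pos by simp
  finally show ?thesis
    using linear_overD(2)[OF F] linear_overD(3)[OF F, of 0 x] by simp
qed

lemma lin_coeff_single_support:
  assumes F: "linear_over prime_subfield (*) F"
    and a: "\<And>n. lin_coeff F n \<noteq> 0 \<Longrightarrow> [n = a] (mod m)"
  shows "F x = lin_coeff F (a mod m) * x ^ (p ^ (a mod m))"
proof -
  have "F x = (\<Sum>n<m. if n = a mod m then lin_coeff F n * x ^ (p ^ n) else 0)"
    unfolding lin_coeff_expansion[OF F, of x]
    by (intro sum.cong refl) (metis a cong_def lessThan_iff mod_less mult_zero_left)
  also have "\<dots> = lin_coeff F (a mod m) * x ^ (p ^ (a mod m))"
    using m_pos by (subst sum.delta) auto
  finally show ?thesis .
qed

section \<open>Coefficients of biadditive maps\<close>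

text \<open>For biadditive \<open>\<Phi>\<close> this is the coefficient of
  \<open>x ^ (p ^ i) * u ^ (p ^ j)\<close>.\<close>

definition bilin_coeff :: "('a \<Rightarrow> 'a \<Rightarrow> 'a) \<Rightarrow> nat \<Rightarrow> nat \<Rightarrow> 'a" where
  "bilin_coeff \<Phi> i j = lin_coeff (\<lambda>u. lin_coeff (\<lambda>x. \<Phi> x u) i) j"

lemma bilin_coeff_add:
  "bilin_coeff (\<lambda>x u. \<Phi> x u + \<Psi> x u) i j = bilin_coeff \<Phi> i j + bilin_coeff \<Psi> i j"
  by (simp add: bilin_coeff_def lin_coeff_add)

lemma bilin_coeff_cmult: "bilin_coeff (\<lambda>x u. c * \<Phi> x u) i j = c * bilin_coeff \<Phi> i j"
  by (simp add: bilin_coeff_def lin_coeff_cmult)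

lemma bilin_coeff_sum:
  "bilin_coeff (\<lambda>x u. \<Sum>n\<in>S. \<Phi> n x u) i j = (\<Sum>n\<in>S. bilin_coeff (\<Phi> n) i j)"
  by (simp add: bilin_coeff_def lin_coeff_sum)

lemma bilin_coeff_prod: "bilin_coeff (\<lambda>x u. F x * G u) i j = lin_coeff F i * lin_coeff G j"
  by (simp add: bilin_coeff_def lin_coeff_cmult lin_coeff_cmult')

text \<open>Substitute the expansion of \<open>h\<close>: its \<open>n\<close>-th coefficient lands
  at position \<open>(n + k, n)\<close> and, times \<open>A ^ (p ^ n)\<close>, at
  \<open>(n, n + k)\<close>, modulo \<open>m\<close>.\<close>

lemma bilin_coeff_twisted:
  assumes h: "linear_over prime_subfield (*) h"
  shows "bilin_coeff (\<lambda>x v. h (x ^ (p ^ k) * v + A * x * v ^ (p ^ k))) i j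
    = (\<Sum>n<m. lin_coeff h n * ((if [n + k = i] (mod m) \<and> [n = j] (mod m) then 1 else 0)
        + (if [n = i] (mod m) \<and> [n + k = j] (mod m) then A ^ (p ^ n) else 0)))"
proof -
  have "h (x ^ (p ^ k) * v + A * x * v ^ (p ^ k)) = (\<Sum>n<m. lin_coeff h n *
      (x ^ (p ^ (n + k)) * v ^ (p ^ n) + A ^ (p ^ n) * (x ^ (p ^ n) * v ^ (p ^ (n + k)))))" for x v
    by (simp add: lin_coeff_expansion[OF h, of "_ + _"] frobenius_add power_mult_distrib mult_ac power_add
        flip: power_mult)
  then show ?thesis
    by (simp add: bilin_coeff_sum bilin_coeff_cmult bilin_coeff_add bilin_coeff_prod lin_coeff_monom)
      (intro sum.cong; auto)
qed

lemma bilin_coeff_twisted_eq_0: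
  assumes "linear_over prime_subfield (*) h"
    and "\<not> [i = j + k] (mod m)" "\<not> [j = i + k] (mod m)"
  shows "bilin_coeff (\<lambda>x v. h (x ^ (p ^ k) * v + A * x * v ^ (p ^ k))) i j = 0"
  unfolding bilin_coeff_twisted[OF assms(1)]
proof (intro sum.neutral ballI)
  fix n
  have "\<not> ([n + k = i] (mod m) \<and> [n = j] (mod m))"
    using assms(2) by (metis cong_add_rcancel_nat cong_sym cong_trans)
  moreover have "\<not> ([n = i] (mod m) \<and> [n + k = j] (mod m))"
    using assms(3) by (metis cong_add_rcancel_nat cong_sym cong_trans)
  ultimately have "(if [n + k = i] (mod m) \<and> [n = j] (mod m) then 1 else 0)
        + (if [n = i] (mod m) \<and> [n + k = j] (mod m) then A ^ (p ^ n) else 0) = 0"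
    by auto
  then show "lin_coeff h n * ((if [n + k = i] (mod m) \<and> [n = j] (mod m) then 1 else 0)
        + (if [n = i] (mod m) \<and> [n + k = j] (mod m) then A ^ (p ^ n) else 0)) = 0"
    by (simp only: mult_zero_right)
qed

text \<open>Two terms can share a position only if \<open>n' = n + k\<close> and
  \<open>n = n' + k\<close> modulo \<open>m\<close>, which would make \<open>m\<close> divide
  \<open>2 * k\<close>.\<close>

lemma bilin_coeff_twisted_shift:
  assumes h: "linear_over prime_subfield (*) h" and "\<not> m dvd 2 * k" and "n < m"
  shows "bilin_coeff (\<lambda>x v. h (x ^ (p ^ k) * v + A * x * v ^ (p ^ k))) (n + k) n = lin_coeff h n"
    and "bilin_coeff (\<lambda>x v. h (x ^ (p ^ k) * v + A * x * v ^ (p ^ k))) n (n + k)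
      = A ^ (p ^ n) * lin_coeff h n"
proof -
  have 1: "[n' = n] (mod m) \<longleftrightarrow> n' = n" if "n' < m" for n'
    using that \<open>n < m\<close> by (simp add: cong_def)
  have 2: "\<not> ([n' = n + k] (mod m) \<and> [n' + k = n] (mod m))" for n'
  proof
    assume *: "[n' = n + k] (mod m) \<and> [n' + k = n] (mod m)"
    then have "[n' + k = n + k + k] (mod m)"
      by (simp add: cong_add_rcancel_nat)
    with * have "[n + 2 * k = n + 0] (mod m)"
      by (metis add.assoc add.right_neutral cong_sym cong_trans mult_2)
    then show False
      using assms(2) by (metis cong_0_iff cong_add_lcancel_nat)
  qed
  have "bilin_coeff (\<lambda>x v. h (x ^ (p ^ k) * v + A * x * v ^ (p ^ k))) (n + k) n
      = (\<Sum>n'<m. if n' = n then lin_coeff h n' else 0)"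
    unfolding bilin_coeff_twisted[OF h] using 1 2 by (intro sum.cong) auto
  then show "bilin_coeff (\<lambda>x v. h (x ^ (p ^ k) * v + A * x * v ^ (p ^ k))) (n + k) n = lin_coeff h n"
    using \<open>n < m\<close> by simp
  have "bilin_coeff (\<lambda>x v. h (x ^ (p ^ k) * v + A * x * v ^ (p ^ k))) n (n + k)
      = (\<Sum>n'<m. if n' = n then A ^ (p ^ n') * lin_coeff h n' else 0)"
    unfolding bilin_coeff_twisted[OF h] using 1 2
    by (intro sum.cong) (auto simp: cong_add_rcancel_nat)
  then show "bilin_coeff (\<lambda>x v. h (x ^ (p ^ k) * v + A * x * v ^ (p ^ k))) n (n + k)
      = A ^ (p ^ n) * lin_coeff h n"
    using \<open>n < m\<close> by simp
qed

end

section \<open>Lines in the plane, and the twisted product with coefficient \<open>A\<close>\<close>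

text \<open>The explicit \<open>h\<close> matters: being a coordinate divided by a constant, it
  stays linear when \<open>x\<close> and \<open>y\<close> are linear in a further variable.\<close>

lemma mem_line:
  fixes s t x y :: "'a::field"
  assumes "s \<noteq> 0 \<or> t \<noteq> 0" and "t * x + s * y = 0"
  defines "h \<equiv> if s \<noteq> 0 then x / s else - (y / t)"
  shows "x = h * s" and "y = h * (- t)"
  using assms(1,2) by (auto simp: h_def field_simps eq_neg_iff_add_eq_0)

context finite_field_card
begin

lemma linear_over_frobenius:
  assumes "linear_over prime_subfield (*) (F :: 'a \<Rightarrow> 'a)"
  shows "linear_over prime_subfield (*) (\<lambda>x. F x ^ (p ^ k))"
  using linear_overD[OF assms]
  by (auto simp: linear_over_def Modules.additive_def frobenius_add power_mult_distrib
      prime_subfield_def frobenius_of_nat)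

text \<open>A coefficient of \<open>h\<close> at \<open>n\<close> shows at \<open>(n + k, n)\<close>
  and \<open>(n, n + k)\<close>, while the right-hand side occupies only \<open>(a + k, b)\<close>
  and \<open>(a, b + k)\<close>. If \<open>n\<close> is not \<open>a\<close> modulo
  \<open>m\<close>, they can match only crosswise: \<open>a = n + k\<close> and
  \<open>a + k = n\<close>, so \<open>m\<close> would divide \<open>2 * k\<close>.\<close>

lemma twisted_monomial:
  fixes h :: "'a \<Rightarrow> 'a"
  assumes h: "linear_over prime_subfield (*) h" and k: "\<not> m dvd 2 * k" and A: "A \<noteq> 0"
    and eq: "\<And>x v. h (x ^ (p ^ k) * v + A * x * v ^ (p ^ k))
      = c * (x ^ (p ^ (a + k)) * v ^ (p ^ b)) + c' * (x ^ (p ^ a) * v ^ (p ^ (b + k)))"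
  shows "is_monomial p h"
proof -
  have coeff: "bilin_coeff (\<lambda>x v. h (x ^ (p ^ k) * v + A * x * v ^ (p ^ k))) i j
      = (if [a + k = i] (mod m) \<and> [b = j] (mod m) then c else 0)
        + (if [a = i] (mod m) \<and> [b + k = j] (mod m) then c' else 0)" for i j
    by (simp add: eq bilin_coeff_add bilin_coeff_cmult bilin_coeff_prod lin_coeff_monom)
  have "[n = a] (mod m)" if "lin_coeff h n \<noteq> 0" "n < m" for n
  proof (rule ccontr)
    assume "\<not> [n = a] (mod m)"
    then have 1: "\<not> [a = n] (mod m)"
      by (simp add: cong_sym_eq)
    then have "\<not> [a + k = n + k] (mod m)"
      by (simp add: cong_add_rcancel_nat)
    then have 2: "[a = n + k] (mod m)"
      using bilin_coeff_twisted_shift(1)[OF h k \<open>n < m\<close>, of A] that unfolding coeff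
      by (auto split: if_splits)
    have "[a + k = n] (mod m)"
      using bilin_coeff_twisted_shift(2)[OF h k \<open>n < m\<close>, of A] that A 1 unfolding coeff
      by (auto split: if_splits)
    moreover have "[a + k = n + k + k] (mod m)"
      using 2 by (simp add: cong_add_rcancel_nat)
    ultimately have "[n + 2 * k = n + 0] (mod m)"
      by (metis add.assoc add.right_neutral cong_sym cong_trans mult_2)
    then show False
      using k by (metis cong_0_iff cong_add_lcancel_nat)
  qed
  moreover have "lin_coeff h (n mod m) = lin_coeff h n" for n
    by (simp add: lin_coeff_def flip: frobenius_mod)
  ultimately have "[n = a] (mod m)" if "lin_coeff h n \<noteq> 0" for n
    using that m_pos by (metis cong_def mod_less_divisor mod_mod_trivial)
  then show ?thesis
    unfolding is_monomial_def using lin_coeff_single_support[OF h, of a] by blast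
qed

end

section \<open>Isotopisms of the product \<open>x ^ q * u + x * u ^ q\<close>\<close>

text \<open>The conditions on \<open>k\<close> and \<open>l\<close> say that
  \<open>x \<mapsto> x ^ (p ^ k)\<close> is a nontrivial field automorphism of odd order: its
  \<open>l\<close>-th iterate is the identity. It is used with \<open>l = m div e\<close>.\<close>

locale odd_twist = finite_field_card p m field_type
  for p m :: nat and field_type :: "'a::{field,finite} itself" +
  fixes k l :: nat
  assumes odd_p: "odd p" and odd_l: "odd l" and m_dvd: "m dvd k * l" and not_dvd: "\<not> m dvd k"
begin

text \<open>Since \<open>l\<close> is odd, the gcd of \<open>2 ^ s * k\<close> and
  \<open>l * k\<close> is \<open>k\<close>.\<close>

lemma not_dvd_power_two: "\<not> m dvd 2 ^ s * k"
proof
  assume "m dvd 2 ^ s * k"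
  then have "m dvd gcd (2 ^ s * k) (l * k)"
    using m_dvd by (simp add: mult.commute)
  also have "gcd (2 ^ s * k) (l * k) = k"
    using odd_l by (simp add: coprime_left_2_iff_odd gcd_mult_right flip: coprime_iff_gcd_eq_1)
  finally show False
    using not_dvd by simp
qed

lemma two_neq_zero: "(2::'a) \<noteq> 0"
proof
  assume "(2::'a) = 0"
  then have "of_nat 2 = (0::'a)"
    by simp
  then have "p dvd 2"
    unfolding of_nat_eq_0_iff_char_dvd char_eq .
  then show False
    using odd_p prime_p two_is_prime_nat primes_dvd_imp_eq dvd_refl by blast
qed

text \<open>A kernel element satisfies \<open>x ^ (p ^ k) = - x\<close>; iterating the odd number
  \<open>l\<close> of times gives \<open>x = - x\<close>. Finiteness turns injectivity into
  surjectivity.\<close>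

lemma frobenius_plus_id_surj: "\<exists>x::'a. x ^ (p ^ k) + x = z"
proof -
  have kernel: "x = 0" if "x ^ (p ^ k) + x = 0" for x :: 'a
  proof -
    have *: "x ^ (p ^ k) = - x"
      using that by (simp add: eq_neg_iff_add_eq_0)
    have "x ^ (p ^ (k * j)) = (- 1) ^ j * x" for j
    proof (induction j)
      case (Suc j)
      have "x ^ (p ^ (k * Suc j)) = (x ^ (p ^ (k * j))) ^ (p ^ k)"
        by (simp only: mult_Suc_right add.commute[of k] power_add[of p] power_mult[of x])
      also have "\<dots> = ((- 1) ^ (p ^ k)) ^ j * x ^ (p ^ k)"
        unfolding Suc.IH power_mult_distrib power_mult[symmetric] by (simp only: mult.commute)
      also have "(- 1 :: 'a) ^ (p ^ k) = - 1"
        using frobenius_uminus[of 1 k] by simp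
      finally show ?case
        using * by simp
    qed simp
    from this[of l] have "x ^ (p ^ (k * l)) = - x"
      using odd_l by simp
    moreover have "x ^ (p ^ (k * l)) = x"
      using m_dvd by (metis dvd_def power_field_card_power)
    ultimately have "2 * x = 0"
      by (metis add.right_inverse mult_2)
    then show ?thesis
      using two_neq_zero by simp
  qed
  have "inj (\<lambda>x::'a. x ^ (p ^ k) + x)"
  proof (rule injI)
    fix x y :: 'a
    assume *: "x ^ (p ^ k) + x = y ^ (p ^ k) + y"
    have "(x - y) ^ (p ^ k) + (x - y) = (x ^ (p ^ k) + x) - (y ^ (p ^ k) + y)"
      by (simp add: frobenius_diff)
    also have "\<dots> = 0"
      using * by simp
    finally have "x - y = 0"
      by (rule kernel)
    then show "x = y"
      by simp
  qed
  then have "surj (\<lambda>x::'a. x ^ (p ^ k) + x)"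
    by (intro finite_UNIV_inj_surj finite)
  then obtain x :: 'a where "z = x ^ (p ^ k) + x"
    by (rule surjE)
  then show ?thesis
    by blast
qed

text \<open>The diagonal coefficients vanish on the left and are \<open>C\<close> times the squares
  of those of \<open>G\<close> on the right. The value \<open>f 2\<close> arises at
  \<open>x = u = 1\<close>.\<close>

lemma twisted_product_form:
  fixes f G :: "'a \<Rightarrow> 'a"
  assumes f: "linear_over prime_subfield (*) f" and G: "linear_over prime_subfield (*) G"
    and eq: "\<And>x u. f (x ^ (p ^ k) * u + x * u ^ (p ^ k)) = C * (G x * G u)"
  shows "f 2 = 0"
proof (cases "C = 0")
  case True
  then show ?thesis
    using eq[of 1 1] by simp
next
  case False
  have "lin_coeff G i = 0" for i
  proof -
    have "\<not> [i = i + k] (mod m)"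
      using not_dvd by (metis add.right_neutral cong_0_iff cong_add_lcancel_nat cong_sym_eq)
    then have "bilin_coeff (\<lambda>x u. C * (G x * G u)) i i = 0"
      using bilin_coeff_twisted_eq_0[OF f, of i i k 1] by (simp add: eq)
    then show ?thesis
      using False by (simp add: bilin_coeff_cmult bilin_coeff_prod)
  qed
  then have "G x = 0" for x
    by (simp add: lin_coeff_expansion[OF G])
  then show ?thesis
    using eq[of 1 1] by simp
qed

text \<open>The left-hand side occupies only positions whose indices differ by \<open>k\<close>;
  each other position yields an equation between coefficients of \<open>G\<close>.\<close>

lemma twisted_self_isotopism_monomial:
  fixes f G :: "'a \<Rightarrow> 'a"
  assumes f: "linear_over prime_subfield (*) f" and G: "linear_over prime_subfield (*) G"
    and C: "C \<noteq> 0"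
    and eq: "\<And>x u. f (x ^ (p ^ k) * u + x * u ^ (p ^ k))
      = C * (G x ^ (p ^ k) * G u + G x * G u ^ (p ^ k))"
  shows "\<exists>g a. \<forall>x. G x = g * x ^ (p ^ a)"
proof (cases "\<exists>i. lin_coeff G i \<noteq> 0")
  case False
  then have "\<forall>x. G x = 0 * x ^ (p ^ 0)"
    by (simp add: lin_coeff_expansion[OF G])
  then show ?thesis
    by blast
next
  case True
  then obtain i where i: "lin_coeff G i \<noteq> 0"
    by blast
  let ?L = "bilin_coeff (\<lambda>x u. C * (G x ^ (p ^ k) * G u + G x * G u ^ (p ^ k)))"
  have L: "?L i j = C * (lin_coeff (\<lambda>x. G x ^ (p ^ k)) i * lin_coeff G j
      + lin_coeff G i * lin_coeff (\<lambda>x. G x ^ (p ^ k)) j)" for i j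
    by (simp add: bilin_coeff_add bilin_coeff_cmult bilin_coeff_prod)
  have L0: "?L i j = 0" if "\<not> [i = j + k] (mod m)" "\<not> [j = i + k] (mod m)" for i j
    using bilin_coeff_twisted_eq_0[OF f that, of 1] by (simp add: eq)
  \<comment> \<open>At \<open>(i + k, i + k)\<close> both products coincide, so their sum is twice
    one of them and \<open>p\<close> being odd applies.\<close>
  have shift: "lin_coeff G (i + k) = 0" if "lin_coeff G i \<noteq> 0" for i
  proof -
    have "\<not> [i + k = i + k + k] (mod m)"
      using not_dvd by (metis add.right_neutral cong_0_iff cong_add_lcancel_nat cong_sym_eq)
    from L0[OF this this] have "C * (lin_coeff G i ^ (p ^ k) * lin_coeff G (i + k)
        + lin_coeff G (i + k) * lin_coeff G i ^ (p ^ k)) = 0"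
      unfolding L lin_coeff_power .
    also have "lin_coeff G i ^ (p ^ k) * lin_coeff G (i + k) + lin_coeff G (i + k) * lin_coeff G i ^ (p ^ k)
        = 2 * (lin_coeff G i ^ (p ^ k) * lin_coeff G (i + k))"
      by simp
    finally have "2 * (lin_coeff G i ^ (p ^ k) * lin_coeff G (i + k)) = 0"
      using C by simp
    then show ?thesis
      using that two_neq_zero by simp
  qed
  \<comment> \<open>At \<open>(i + k, j)\<close> the second product contains
    \<open>lin_coeff G (i + k)\<close>, zero by \<open>shift\<close>, so nothing cancels the
    first.\<close>
  have pair: "[j = i] (mod m) \<or> [j = i + 2 * k] (mod m)"
    if "lin_coeff G i \<noteq> 0" "lin_coeff G j \<noteq> 0" for i j
  proof (rule ccontr)
    assume *: "\<not> ?thesis"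
    have "\<not> [i + k = j + k] (mod m)"
      using * by (metis cong_add_rcancel_nat cong_sym)
    moreover have "\<not> [j = i + k + k] (mod m)"
      using * by (simp add: add.assoc mult_2)
    ultimately have "?L (i + k) j = 0"
      by (rule L0)
    then show False
      using C shift[OF that(1)] that by (simp add: L lin_coeff_power)
  qed
  \<comment> \<open>Two distinct support indices would each exceed the other by
    \<open>2 * k\<close>, forcing \<open>m\<close> to divide \<open>4 * k\<close>.\<close>
  have "[n = i] (mod m)" if n: "lin_coeff G n \<noteq> 0" for n
  proof (rule ccontr)
    assume *: "\<not> [n = i] (mod m)"
    with pair[OF i n] pair[OF n i] have "[n = i + 2 * k] (mod m)" "[i = n + 2 * k] (mod m)"
      using cong_sym by blast+
    moreover from this have "[n + 2 * k = i + 2 * k + 2 * k] (mod m)"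
      by (simp only: cong_add_rcancel_nat)
    moreover have "i + 2 * k + 2 * k = i + 2 ^ 2 * k"
      by simp
    ultimately have "[i + 2 ^ 2 * k = i + 0] (mod m)"
      by (metis add.right_neutral cong_sym cong_trans)
    then show False
      using not_dvd_power_two[of 2] by (metis cong_0_iff cong_add_lcancel_nat)
  qed
  then show ?thesis
    using lin_coeff_single_support[OF G, of i] by blast
qed

text \<open>Rewritten through the bijection \<open>G\<close>, the symmetry of the left-hand side in \<open>x\<close> and
  \<open>u\<close> forces \<open>K = H \<circ> G\<^sup>-\<^sup>1\<close> and \<open>z \<mapsto> K z ^ q\<close> to be combinations of \<open>z\<close> and
  \<open>z ^ q\<close>; independence of \<open>z\<close>, \<open>z ^ q\<close>, \<open>z ^ (q ^ 2)\<close> then leaves only multiples of \<open>z\<close>.\<close>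

lemma twisted_isotopism_monomial:
  fixes f G H :: "'a \<Rightarrow> 'a"
  assumes f: "linear_over prime_subfield (*) f" and G: "linear_over prime_subfield (*) G"
    and "bij G" and f2: "f 2 \<noteq> 0"
    and eq: "\<And>x u. f (x ^ (p ^ k) * u + x * u ^ (p ^ k))
      = c * (G x ^ (p ^ k) * H u) + c' * (G x * H u ^ (p ^ k))"
  obtains \<phi> a \<gamma> \<eta> where "\<forall>x. f x = \<phi> * x ^ (p ^ a)" "\<forall>x. G x = \<gamma> * x ^ (p ^ a)"
    "\<forall>x. H x = \<eta> * x ^ (p ^ a)"
proof -
  define q where "q = p ^ k"
  define K where "K z = H (inv G z)" for z
  have K: "H x = K (G x)" for x
    using \<open>bij G\<close> by (simp add: K_def bij_is_inj)
  have sym: "c * (z ^ q * K w) + c' * (z * K w ^ q) = c * (w ^ q * K z) + c' * (w * K z ^ q)" for z w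
  proof -
    obtain x u where "z = G x" "w = G u"
      using \<open>bij G\<close> by (metis bij_pointE)
    then show ?thesis
      using eq[of x u] eq[of u x] by (simp add: K q_def add.commute mult.commute)
  qed
  obtain w :: 'a where w: "w ^ q \<noteq> w"
    using frobenius_distinct[of k 0] not_dvd by (auto simp: cong_0_iff q_def)
  have c: "c \<noteq> 0"
  proof
    assume c: "c = 0"
    moreover have "c' \<noteq> 0"
      using f2 eq[of 1 1] c by auto
    ultimately have Kq: "K z ^ q = z * K 1 ^ q" for z
      using sym[of z 1] by simp
    have "f (x ^ (p ^ k) * u + x * u ^ (p ^ k)) = (c' * K 1 ^ q) * (G x * G u)" for x u
      unfolding eq K Kq[of "G u", unfolded q_def] by (simp add: c q_def mult_ac)
    then show False
      using twisted_product_form[OF f G] f2 by blast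
  qed
  have c': "c' \<noteq> 0"
  proof
    assume c': "c' = 0"
    have Kq: "K z = z ^ q * K 1" for z
      using c' sym[of z 1] c by simp
    have "f (x ^ (p ^ k) * u + x * u ^ (p ^ k)) = (c * K 1) * (G x ^ (p ^ k) * G u ^ (p ^ k))" for x u
      unfolding eq K Kq[of "G u"] by (simp add: c' q_def mult_ac)
    then show False
      using twisted_product_form[OF f linear_over_frobenius[OF G]] f2 by blast
  qed
  define D where "D = w ^ q - w"
  have D: "D \<noteq> 0"
    using w by (simp add: D_def)
  \<comment> \<open>Cramer's rule: \<open>sym\<close> at \<open>(z, w)\<close> and at
    \<open>(z, 1)\<close> are two linear equations for \<open>c * K z\<close> and
    \<open>c' * K z ^ q\<close>, with determinant \<open>D\<close> up to sign.\<close>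
  define \<alpha> where "\<alpha> = c' * (K w ^ q - w * K 1 ^ q) / (c * D)"
  define \<beta> where "\<beta> = c * (K w - w * K 1) / (c * D)"
  define \<gamma> where "\<gamma> = - (c' * (K w ^ q - w ^ q * K 1 ^ q) / (c' * D))"
  define \<delta> where "\<delta> = - (c * (K w - w ^ q * K 1) / (c' * D))"
  have K1: "K z = \<alpha> * z + \<beta> * z ^ q" for z
  proof -
    have "c * D * K z = c' * (K w ^ q - w * K 1 ^ q) * z + c * (K w - w * K 1) * z ^ q"
      using sym[of z w] arg_cong[OF sym[of z 1], of "\<lambda>t. w * t"] unfolding D_def
      by (simp add: algebra_simps)
    also have "\<dots> = c * D * (\<alpha> * z + \<beta> * z ^ q)"
      using c D by (simp add: \<alpha>_def \<beta>_def distrib_left)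
    finally show ?thesis
      using c D by simp
  qed
  have K2: "K z ^ q = \<gamma> * z + \<delta> * z ^ q" for z
  proof -
    have "c' * D * K z ^ q = - (c' * (K w ^ q - w ^ q * K 1 ^ q) * z) - c * (K w - w ^ q * K 1) * z ^ q"
      using sym[of z w] arg_cong[OF sym[of z 1], of "\<lambda>t. w ^ q * t"] unfolding D_def
      by (simp add: algebra_simps)
    also have "\<dots> = c' * D * (\<gamma> * z + \<delta> * z ^ q)"
      using c' D by (simp add: \<gamma>_def \<delta>_def right_diff_distrib)
    finally show ?thesis
      using c' D by simp
  qed
  have "\<alpha> ^ q * z ^ (p ^ k) + \<beta> ^ q * z ^ (p ^ (2 * k)) = \<gamma> * z ^ (p ^ 0) + \<delta> * z ^ (p ^ k)" for z
    using K2[of z] unfolding K1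
    by (simp add: q_def frobenius_add power_mult_distrib mult_2 power_add flip: power_mult)
  \<comment> \<open>Only the term with \<open>\<beta> ^ q\<close> has index \<open>2 * k\<close>
    modulo \<open>m\<close>.\<close>
  then have "lin_coeff (\<lambda>z. \<alpha> ^ q * z ^ (p ^ k) + \<beta> ^ q * z ^ (p ^ (2 * k))) (2 * k)
      = lin_coeff (\<lambda>z. \<gamma> * z ^ (p ^ 0) + \<delta> * z ^ (p ^ k)) (2 * k)"
    by simp
  moreover have "\<not> [k = 2 * k] (mod m)"
    using not_dvd by (metis add.right_neutral cong_0_iff cong_add_lcancel_nat cong_sym_eq mult_2)
  moreover have "\<not> [0 = 2 * k] (mod m)"
    using not_dvd_power_two[of 1] by (metis cong_0_iff cong_sym_eq power_one_right)
  ultimately have "\<beta> ^ q = 0"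
    unfolding lin_coeff_add lin_coeff_cmult lin_coeff_monom by simp
  then have K\<alpha>: "K z = \<alpha> * z" for z
    using K1 by simp
  define C where "C = c * \<alpha>"
  have "c * \<alpha> * D = c' * \<alpha> ^ q * D"
    using sym[of 1 w] unfolding K\<alpha> D_def by (simp add: algebra_simps power_mult_distrib)
  then have C': "c' * \<alpha> ^ q = C"
    using D by (simp add: C_def)
  have twist: "f (x ^ (p ^ k) * u + x * u ^ (p ^ k))
      = C * (G x ^ (p ^ k) * G u + G x * G u ^ (p ^ k))" for x u
  proof -
    have "f (x ^ (p ^ k) * u + x * u ^ (p ^ k))
        = c * \<alpha> * (G x ^ q * G u) + c' * \<alpha> ^ q * (G x * G u ^ q)"
      unfolding eq K K\<alpha> by (simp add: q_def power_mult_distrib mult_ac)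
    then show ?thesis
      unfolding C' by (simp add: C_def q_def algebra_simps)
  qed
  have "C \<noteq> 0"
    using twist[of 1 1] f2 by auto
  then obtain g a where g: "\<And>x. G x = g * x ^ (p ^ a)"
    using twisted_self_isotopism_monomial[OF f G _ twist] by blast
  \<comment> \<open>Putting \<open>u = 1\<close> determines \<open>f\<close> on the values
    \<open>x ^ q + x\<close>, which exhaust the field.\<close>
  have "f z = C * g ^ q * g * z ^ (p ^ a)" for z
  proof -
    obtain x where x: "z = x ^ (p ^ k) + x"
      using frobenius_plus_id_surj[of z] by metis
    have swap: "(x ^ (p ^ a)) ^ q = (x ^ q) ^ (p ^ a)"
      by (simp add: mult.commute flip: power_mult)
    have "f z = C * (G x ^ q * G 1 + G x * G 1 ^ q)"
      using twist[of x 1] by (simp add: x q_def)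
    also have "\<dots> = C * g ^ q * g * ((x ^ q) ^ (p ^ a) + x ^ (p ^ a))"
      by (simp add: g power_mult_distrib swap algebra_simps)
    also have "(x ^ q) ^ (p ^ a) + x ^ (p ^ a) = z ^ (p ^ a)"
      by (simp add: x q_def frobenius_add)
    finally show ?thesis .
  qed
  moreover have "H x = \<alpha> * g * x ^ (p ^ a)" for x
    by (simp add: K K\<alpha> g)
  ultimately show ?thesis
    using g that by blast
qed

text \<open>Fixing one argument in \<open>line1\<close> and \<open>line2\<close> puts
  \<open>(g1 x, g2 x)\<close> and \<open>(n1 u, n2 u)\<close> on fixed lines. Their parameters
  \<open>G x\<close> and \<open>H u\<close> reduce the equation to
  \<open>twisted_isotopism_monomial\<close>.\<close>

lemma twisted_isotopism_plane_monomial: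
  fixes f g1 g2 n1 n2 :: "'a \<Rightarrow> 'a"
  assumes f: "linear_over prime_subfield (*) f" and f2: "f 2 \<noteq> 0"
    and g1: "linear_over prime_subfield (*) g1" and g2: "linear_over prime_subfield (*) g2"
    and inj: "\<And>x. g1 x = 0 \<Longrightarrow> g2 x = 0 \<Longrightarrow> x = 0" and A: "A \<noteq> 0" and r: "r > 0"
    and eq: "\<And>x u. f (x ^ (p ^ k) * u + x * u ^ (p ^ k))
      = g1 x ^ (p ^ k) * n1 u + g1 x * n1 u ^ (p ^ k)
        + B * (g2 x ^ (p ^ k) * n2 u + g2 x * n2 u ^ (p ^ k))"
    and line1: "\<And>x u. g1 x ^ r * n2 u + A * g2 x ^ r * n1 u = 0"
    and line2: "\<And>x u. A * g1 x * n2 u ^ r + g2 x * n1 u ^ r = 0"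
  obtains \<phi> a \<gamma>1 \<gamma>2 \<nu>1 \<nu>2 where "\<forall>x. f x = \<phi> * x ^ (p ^ a)"
    "\<forall>x. g1 x = \<gamma>1 * x ^ (p ^ a)" "\<forall>x. g2 x = \<gamma>2 * x ^ (p ^ a)"
    "\<forall>x. n1 x = \<nu>1 * x ^ (p ^ a)" "\<forall>x. n2 x = \<nu>2 * x ^ (p ^ a)"
proof -
  define s t where "s = n1 1 ^ r" and "t = A * n2 1 ^ r"
  define s' t' where "s' = g1 1 ^ r" and "t' = A * g2 1 ^ r"
  define G where "G x = (if s \<noteq> 0 then g1 x / s else - (g2 x / t))" for x
  define H where "H u = (if s' \<noteq> 0 then n1 u / s' else - (n2 u / t'))" for u
  have "n1 1 \<noteq> 0 \<or> n2 1 \<noteq> 0"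
    using f2 eq[of 1 1] prime_p by (auto simp: frobenius_zero)
  then have "s \<noteq> 0 \<or> t \<noteq> 0"
    using A r by (simp add: s_def t_def)
  then have g: "g1 x = G x * s" "g2 x = G x * (- t)" for x
    using mem_line[of s t "g1 x" "g2 x"] line2[of x 1] by (simp_all add: G_def s_def t_def mult_ac)
  have "g1 1 \<noteq> 0 \<or> g2 1 \<noteq> 0"
    using inj[of 1] by auto
  then have "s' \<noteq> 0 \<or> t' \<noteq> 0"
    using A r by (simp add: s'_def t'_def)
  then have n: "n1 u = H u * s'" "n2 u = H u * (- t')" for u
    using mem_line[of s' t' "n1 u" "n2 u"] line1[of 1 u]
    by (simp_all add: H_def s'_def t'_def mult_ac add.commute)
  have linG: "linear_over prime_subfield (*) G"
  proof (cases "s = 0")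
    case True
    then have G_eq: "G = (\<lambda>x. (- 1 / t) * g2 x)"
      by (auto simp: G_def)
    show ?thesis
      unfolding G_eq by (rule linear_over_cmult_compose[OF g2])
  next
    case False
    then have G_eq: "G = (\<lambda>x. (1 / s) * g1 x)"
      by (auto simp: G_def)
    show ?thesis
      unfolding G_eq by (rule linear_over_cmult_compose[OF g1])
  qed
  have "x = 0" if "G x = 0" for x
    using inj[of x] g[of x] that by simp
  then have "inj G"
    using linear_overD(3)[OF linG] by (metis eq_iff_diff_eq_0 injI)
  then have "bij G"
    by (simp add: bij_def finite_UNIV_inj_surj[OF finite])
  define c where "c = s ^ (p ^ k) * s' + B * ((- t) ^ (p ^ k) * (- t'))"
  define c' where "c' = s * s' ^ (p ^ k) + B * ((- t) * (- t') ^ (p ^ k))"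
  have twist: "f (x ^ (p ^ k) * u + x * u ^ (p ^ k))
      = c * (G x ^ (p ^ k) * H u) + c' * (G x * H u ^ (p ^ k))" for x u
    unfolding eq g n c_def c'_def power_mult_distrib by (simp add: algebra_simps)
  obtain \<phi> a \<gamma> \<eta> where *: "\<forall>x. f x = \<phi> * x ^ (p ^ a)" "\<forall>x. G x = \<gamma> * x ^ (p ^ a)"
    "\<forall>x. H x = \<eta> * x ^ (p ^ a)"
    by (rule twisted_isotopism_monomial[OF f linG \<open>bij G\<close> f2 twist])
  show ?thesis
    by (rule that[of \<phi> a "\<gamma> * s" "\<gamma> * (- t)" "\<eta> * s'" "\<eta> * (- t')"])
      (unfold g n *[rule_format], simp_all add: mult_ac)
qed

end

section \<open>Separating the \<open>r\<close>-th powers from the linear terms\<close>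

context finite_field_card
begin

text \<open>On the subfield of order \<open>p ^ gcd k m\<close> the power map with exponent \<open>q\<close> is trivial,
  so the one with exponent \<open>r = q * p ^ (m div 2)\<close> is the involution of that subfield.\<close>

lemma subfield_moved_element:
  fixes K :: "'a set"
  assumes K: "is_subfield K" and card_K: "card K = p ^ e" and e: "e = gcd k m"
    and odd: "odd (m div e)" and even: "even m"
  obtains \<mu> where "\<mu> \<in> K" "\<mu> ^ (p ^ (k + m div 2)) \<noteq> \<mu>"
proof -
  have "e > 0"
    using e m_pos by simp
  obtain t where "m div e = 2 * t + 1"
    using odd by (elim oddE)
  then have m: "m = e * (2 * t + 1)"
    using dvd_mult_div_cancel[of e m] e by (metis gcd_dvd2)
  \<comment> \<open>As \<open>m\<close> is even and its cofactor is odd, \<open>e\<close> is even,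
    say \<open>2 * e'\<close>, and half of \<open>m\<close> is \<open>e'\<close> plus a multiple of
    \<open>e\<close>.\<close>
  have "even (e * (2 * t + 1))"
    using even by (simp only: m)
  then obtain e' where e': "e = 2 * e'"
    by (auto elim: evenE)
  have half: "m div 2 = e * t + e'"
    unfolding m e' by simp
  obtain s where s: "k = e * s"
    using e by (metis gcd_dvd1 dvdE)
  have fix_e: "x ^ (p ^ (e * j)) = x" if "x \<in> K" for x j
  proof (induction j)
    case (Suc j)
    then show ?case
      using is_subfield_power_card[OF K that]
      by (simp only: mult_Suc_right power_add[of p] power_mult[of x] card_K)
  qed simp
  have "k + m div 2 = e * (s + t) + e'"
    unfolding half by (simp add: s distrib_left)
  then have r: "x ^ (p ^ (k + m div 2)) = x ^ (p ^ e')" if "x \<in> K" for x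
    by (simp only: power_add[of p] power_mult[of x] fix_e[OF that])
  have "\<exists>x\<in>K. x ^ (p ^ (e')) \<noteq> x"
  proof (rule ccontr)
    assume "\<not> ?thesis"
    then have "K \<subseteq> {x. x ^ 1 = x ^ (p ^ (e'))}"
      by auto
    then have "card K \<le> card {x::'a. x ^ 1 = x ^ (p ^ (e'))}"
      by (intro card_mono finite)
    also have "\<dots> \<le> p ^ (e')"
      using \<open>e > 0\<close> prime_gt_1_nat[OF prime_p]
      by (intro card_roots_power_diff_le one_less_power) (simp_all add: e')
    also have "\<dots> < p ^ e"
      using \<open>e > 0\<close> prime_gt_1_nat[OF prime_p] by (simp add: e')
    finally show False
      by (simp add: card_K)
  qed
  then show ?thesis
    using r that by metis
qed

end

text \<open>The linear system for \<open>\<alpha>\<close> and \<open>\<beta>\<close> has determinant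
  \<open>\<mu> - \<mu> ^ r\<close>.\<close>

lemma semilinear_split_zero:
  fixes \<mu> :: "'a::field"
  assumes "\<mu> ^ r \<noteq> \<mu>" and "\<alpha> + \<beta> = 0" and "\<mu> ^ r * \<alpha> + \<mu> * \<beta> = 0"
  shows "\<alpha> = 0" and "\<beta> = 0"
proof -
  have "\<alpha> = - \<beta>"
    using assms(2) by (simp add: eq_neg_iff_add_eq_0)
  then have "(\<mu> - \<mu> ^ r) * \<beta> = 0"
    using assms(3) by (simp add: algebra_simps)
  then show "\<beta> = 0"
    using assms(1) by simp
  with assms(2) show "\<alpha> = 0"
    by simp
qed

section \<open>Diagonal automorphisms, one coordinate axis at a time\<close>

theorem theorem4p9:
  fixes p m k q r Q e d :: nat
    and FQ EE DD :: "'a::{field,finite} set"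
    and A B :: 'a
    and X Y :: "'a \<times> 'a \<Rightarrow> 'a \<times> 'a"
    and f1 f2 f3 f4 g1 g2 g3 g4 :: "'a \<Rightarrow> 'a"
  assumes "prime p" and "odd p"
    and "even m"
    and "CARD('a) = p ^ m"
    and "Q = p ^ (m div 2)"
    and "1 \<le> k" and "k \<le> m - 1"
    and "q = p ^ k" and "r = p ^ (k + m div 2)"
    and "e = gcd k m" and "odd (m div e)"
    and "d = gcd (k + m div 2) m"
    and "is_subfield EE" and "card EE = p ^ e"
    and "is_subfield DD" and "card DD = p ^ d"
    and "is_subfield FQ" and "card FQ = Q"
    and "\<nexists>z. B = z ^ 2"
    and "A * B \<in> FQ - {0}"
    and "(X, Y) \<in> Aut (C_set q r A B)"
    and "\<forall>f\<in>{f1, f2, f3, f4, g1, g2, g3, g4}. linear_over prime_subfield (*) f"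
    and "\<And>x y. X (x, y) = (f1 x + f2 y, f3 x + f4 y)"
    and "\<And>x y. Y (x, y) = (g1 x + g2 y, g3 x + g4 y)"
    and "semilinear_over DD scale2 X"
    and "semilinear_over EE scale2 Y"
    and "f2 = (\<lambda>x. 0)" and "f3 = (\<lambda>x. 0)"
  shows "\<forall>f\<in>{f1, f4, g1, g2, g3, g4}. is_monomial p f"
proof -
  interpret finite_field_card p m "TYPE('a)"
    using assms by unfold_locales
  have k: "\<not> m dvd k"
    using assms(6,7) nat_dvd_not_less[of k m] by linarith
  have "k * (m div e) = k div e * m"
    using assms(10) by (simp add: div_mult_swap dvd_div_mult)
  then have "m dvd k * (m div e)"
    by simp
  then interpret odd_twist p m "TYPE('a)" k "m div e"
    using assms k by unfold_locales
  define \<kappa> where "\<kappa> = k + m div 2"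
  have "2 * \<kappa> = 2 * k + m"
    using assms(3) by (auto simp: \<kappa>_def elim!: evenE)
  then have \<kappa>: "\<not> m dvd 2 * \<kappa>"
    using not_dvd_power_two[of 1] by simp
  have q: "q = p ^ k" and r: "r = p ^ \<kappa>"
    using assms by (simp_all add: \<kappa>_def)
  have AB: "A \<noteq> 0" "B \<noteq> 0"
    using assms(20) by auto
  have lin: "linear_over prime_subfield (*) f1" "linear_over prime_subfield (*) f4"
    "linear_over prime_subfield (*) g1" "linear_over prime_subfield (*) g2"
    "linear_over prime_subfield (*) g3" "linear_over prime_subfield (*) g4"
    using assms(22) by auto
  note zeros = lin[THEN linear_overD(2)]
  have X: "X (x, y) = (f1 x, f4 y)" for x y
    using assms(23,27,28) by simp
  have "bij X" "bij Y"
    using assms(21) by (auto simp: Aut_def)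
  have f1: "f1 x \<noteq> 0" if "x \<noteq> 0" for x
  proof
    assume "f1 x = 0"
    then have "X (x, 0) = X (0, 0)"
      by (simp only: X zeros)
    then show False
      using that injD[OF bij_is_inj[OF \<open>bij X\<close>]] by blast
  qed
  have Y_zero: "x = 0 \<and> y = 0" if "Y (x, y) = 0" for x y
    using that assms(24)[of 0 0] zeros bij_is_inj[OF \<open>bij Y\<close>]
    by (metis Pair_inject add_0 injD zero_prod_def)

  have "\<exists>w t. X \<circ> R_map q r A B u v = R_map q r A B w t \<circ> Y" for u v
    using assms(21) unfolding Aut_def C_set_def by blast
  \<comment> \<open>\<open>W\<close> and \<open>T\<close> are bare choice functions; that they are
    monomial on each axis is a result of the argument.\<close>
  then obtain W T where WT: "X \<circ> R_map q r A B u v = R_map q r A B (W u v) (T u v) \<circ> Y" for u v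
    by metis
  have eq: "f1 (x ^ q * u + x * u ^ q + B * (y ^ q * v + y * v ^ q))
      = (g1 x + g2 y) ^ q * W u v + (g1 x + g2 y) * W u v ^ q
        + B * ((g3 x + g4 y) ^ q * T u v + (g3 x + g4 y) * T u v ^ q)"
    "f4 (x ^ r * v + A * x * v ^ r + A * y ^ r * u + y * u ^ r)
      = (g1 x + g2 y) ^ r * T u v + A * (g1 x + g2 y) * T u v ^ r
        + A * (g3 x + g4 y) ^ r * W u v + (g3 x + g4 y) * W u v ^ r" for x y u v
    using fun_cong[OF WT[of u v], of "(x, y)"] by (simp_all add: R_map_def X assms(24))
  define n1 n2 n3 n4 where "n1 u = W u 0" and "n2 v = W 0 v" and "n3 u = T u 0" and "n4 v = T 0 v"
    for u v
  have q0: "(0::'a) ^ q = 0" and r0: "(0::'a) ^ r = 0"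
    by (simp_all add: q r frobenius_zero)

  obtain \<mu> where \<mu>: "\<mu> \<in> EE" "\<mu> ^ r \<noteq> \<mu>"
    using subfield_moved_element[OF assms(13,14,10,11,3)] unfolding r \<kappa>_def by blast
  \<comment> \<open>\<open>\<nu>\<close> is the preimage of \<open>\<mu>\<close> under the
    automorphism of \<open>EE\<close> that accompanies \<open>Y\<close>.\<close>
  obtain \<nu> where "\<And>z. Y (scale2 \<nu> z) = scale2 \<mu> (Y z)"
    using assms(26) \<mu>(1) unfolding semilinear_over_def field_automorphism_def bij_betw_def
    by (metis imageE)
  from this[of "(_, 0)"] this[of "(0, _)"]
  have scale: "g1 (\<nu> * x) = \<mu> * g1 x" "g3 (\<nu> * x) = \<mu> * g3 x"
    "g2 (\<nu> * x) = \<mu> * g2 x" "g4 (\<nu> * x) = \<mu> * g4 x" for x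
    by (simp_all add: assms(24) scale2_def zeros)

  \<comment> \<open>With \<open>y = v = 0\<close> the argument of \<open>f4\<close>
    vanishes.\<close>
  have second1: "g1 x ^ r * n3 u + A * g1 x * n3 u ^ r + A * g3 x ^ r * n1 u + g3 x * n1 u ^ r = 0" for x u
    using eq(2)[of x 0 0 u] by (simp add: zeros r0 n1_def n3_def)
  have line1: "g1 x ^ r * n3 u + A * g3 x ^ r * n1 u = 0" "A * g1 x * n3 u ^ r + g3 x * n1 u ^ r = 0" for x u
  proof -
    have s: "(g1 x ^ r * n3 u + A * g3 x ^ r * n1 u) + (A * g1 x * n3 u ^ r + g3 x * n1 u ^ r) = 0"
      using second1[of x u] by (simp add: algebra_simps)
    \<comment> \<open>Replacing \<open>x\<close> by \<open>\<nu> * x\<close> scales the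
      \<open>r\<close>-th powers of \<open>g1\<close> and \<open>g3\<close> by
      \<open>\<mu> ^ r\<close> and their linear occurrences by \<open>\<mu>\<close>.\<close>
    have "\<mu> ^ r * (g1 x ^ r * n3 u + A * g3 x ^ r * n1 u) + \<mu> * (A * g1 x * n3 u ^ r + g3 x * n1 u ^ r) = 0"
      using second1[of "\<nu> * x" u] by (simp add: scale power_mult_distrib algebra_simps)
    from semilinear_split_zero[OF \<mu>(2) s this] show "g1 x ^ r * n3 u + A * g3 x ^ r * n1 u = 0" "A * g1 x * n3 u ^ r + g3 x * n1 u ^ r = 0" .
  qed
  have second2: "g2 y ^ r * n4 v + A * g2 y * n4 v ^ r + A * g4 y ^ r * n2 v + g4 y * n2 v ^ r = 0" for y v
    using eq(2)[of 0 v y 0] by (simp add: zeros r0 n2_def n4_def)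
  have line2: "g2 y ^ r * n4 v + A * g4 y ^ r * n2 v = 0" "A * g2 y * n4 v ^ r + g4 y * n2 v ^ r = 0" for y v
  proof -
    have s: "(g2 y ^ r * n4 v + A * g4 y ^ r * n2 v) + (A * g2 y * n4 v ^ r + g4 y * n2 v ^ r) = 0"
      using second2[of y v] by (simp add: algebra_simps)
    have "\<mu> ^ r * (g2 y ^ r * n4 v + A * g4 y ^ r * n2 v) + \<mu> * (A * g2 y * n4 v ^ r + g4 y * n2 v ^ r) = 0"
      using second2[of "\<nu> * y" v] by (simp add: scale power_mult_distrib algebra_simps)
    from semilinear_split_zero[OF \<mu>(2) s this] show "g2 y ^ r * n4 v + A * g4 y ^ r * n2 v = 0" "A * g2 y * n4 v ^ r + g4 y * n2 v ^ r = 0" .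
  qed

  have r_pos: "r > 0"
    using prime_p by (simp add: r prime_gt_0_nat)
  have inj13: "x = 0" if "g1 x = 0" "g3 x = 0" for x
    using Y_zero[of x 0] that by (simp add: assms(24) zeros zero_prod_def)
  have inj24: "y = 0" if "g2 y = 0" "g4 y = 0" for y
    using Y_zero[of 0 y] that by (simp add: assms(24) zeros zero_prod_def)
  have first1: "f1 (x ^ (p ^ k) * u + x * u ^ (p ^ k))
      = g1 x ^ (p ^ k) * n1 u + g1 x * n1 u ^ (p ^ k)
        + B * (g3 x ^ (p ^ k) * n3 u + g3 x * n3 u ^ (p ^ k))" for x u
    using eq(1)[of x u 0 0] by (simp add: zeros q0 n1_def n3_def flip: q)
  \<comment> \<open>The factor \<open>B\<close> is absorbed into the map, so this axis is treated
    with \<open>x \<mapsto> f1 (B * x)\<close>.\<close>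
  have first2: "f1 (B * (y ^ (p ^ k) * v + y * v ^ (p ^ k)))
      = g2 y ^ (p ^ k) * n2 v + g2 y * n2 v ^ (p ^ k)
        + B * (g4 y ^ (p ^ k) * n4 v + g4 y * n4 v ^ (p ^ k))" for y v
    using eq(1)[of 0 0 y v] by (simp add: zeros q0 n2_def n4_def flip: q)
  obtain \<phi> a \<gamma>1 \<gamma>3 \<nu>1 \<nu>3 where mon1: "\<forall>x. f1 x = \<phi> * x ^ (p ^ a)"
    "\<forall>x. g1 x = \<gamma>1 * x ^ (p ^ a)" "\<forall>x. g3 x = \<gamma>3 * x ^ (p ^ a)"
    "\<forall>x. n1 x = \<nu>1 * x ^ (p ^ a)" "\<forall>x. n3 x = \<nu>3 * x ^ (p ^ a)"
    by (rule twisted_isotopism_plane_monomial[OF lin(1) f1[OF two_neq_zero] lin(3,5) inj13 AB(1) r_pos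
        first1 line1])
  have f1B: "f1 (B * 2) \<noteq> 0"
    using f1 AB two_neq_zero by simp
  obtain \<phi>' b \<gamma>2 \<gamma>4 \<nu>2 \<nu>4 where mon2:
    "\<forall>x. f1 (B * x) = \<phi>' * x ^ (p ^ b)"
    "\<forall>x. g2 x = \<gamma>2 * x ^ (p ^ b)" "\<forall>x. g4 x = \<gamma>4 * x ^ (p ^ b)"
    "\<forall>x. n2 x = \<nu>2 * x ^ (p ^ b)" "\<forall>x. n4 x = \<nu>4 * x ^ (p ^ b)"
    by (rule twisted_isotopism_plane_monomial[OF linear_over_compose_cmult[OF lin(1)] f1B lin(4,6) inj24
        AB(1) r_pos first2 line2])
  note mon = mon1[rule_format] mon2[rule_format]
  \<comment> \<open>Mix the axes with \<open>y = u = 0\<close>: \<open>g1\<close> and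
    \<open>g3\<close> carry the exponent \<open>a\<close>, \<open>n2\<close> and \<open>n4\<close>
    the exponent \<open>b\<close>.\<close>
  have "f4 (x ^ (p ^ \<kappa>) * v + A * x * v ^ (p ^ \<kappa>))
      = (\<gamma>1 ^ r * \<nu>4 + A * \<gamma>3 ^ r * \<nu>2) * (x ^ (p ^ (a + \<kappa>)) * v ^ (p ^ b))
        + (A * \<gamma>1 * \<nu>4 ^ r + \<gamma>3 * \<nu>2 ^ r) * (x ^ (p ^ a) * v ^ (p ^ (b + \<kappa>)))" for x v
  proof -
    have "f4 (x ^ r * v + A * x * v ^ r)
        = g1 x ^ r * n4 v + A * g1 x * n4 v ^ r + A * g3 x ^ r * n2 v + g3 x * n2 v ^ r"
      using eq(2)[of x v 0 0] by (simp add: zeros r0 n2_def n4_def)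
    moreover have "(z ^ (p ^ c)) ^ r = z ^ (p ^ (c + \<kappa>))" for z :: 'a and c
      by (simp add: r power_add power_mult)
    ultimately show ?thesis
      by (simp add: mon power_mult_distrib algebra_simps flip: r)
  qed
  then have "is_monomial p f4"
    by (rule twisted_monomial[OF lin(2) \<kappa> AB(1)])
  moreover have "is_monomial p f" if "\<forall>x. f x = \<gamma> * x ^ (p ^ c)" for f :: "'a \<Rightarrow> 'a" and \<gamma> c
    unfolding is_monomial_def fun_eq_iff using that by blast
  note this[OF mon1(1)] this[OF mon1(2)] this[OF mon1(3)] this[OF mon2(2)] this[OF mon2(3)]
  ultimately show ?thesis
    by simp
qed

end
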